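(* Let $g(x)$ and $h(x)$ be symmetric polynomials of the same degree $n\ge1$ with complex coefficients, and let $g_{\delta}(x)=\frac n2 g(x)-xg'(x)$ and $h_{\delta}(x)=\frac n2 h(x)-xh'(x)$. If the roots of $g(x)$ and $h(x)$ are interlacing, then the roots of $g_{\delta}(x)$ and $h_{\delta}(x)$ are interlacing as well.
   Context: A polynomial $g(x)=a_0+a_1x+\dots+a_nx^n$ of degree $n$ with complex coefficients is called symmetric if $g(x)=x^n\overline{g}(1/x)$, where $\overline{g}$ denotes the polynomial whose coefficients are the complex conjugates of those of $g$; i.e. $a_k=\overline{a}_{n-k}$ for all $k$ (in particular $a_0=\overline{a}_n\neq 0$). For symmetric $g$ of degree $n$, $g_\delta$ has degree $n$ and is skew-symmetric: $x^n\overline{g}_\delta(1/x)=-g_\delta(x)$. Two polynomials of degree $n$ (symmetric or skew-symmetric) have interlacing roots if all the roots of each are simple and lie on the circle $|x|=1$, and between any two consecutive roots (on the circle) of one polynomial, i.e. on the open arc joining them, there lies one and only one root of the other polynomial. (For $n=1$ the only arc is the circle with the single root removed, so the condition means that the two roots lie on the circle and are distinct.) *)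

theory Defs
  imports Complex_Main "HOL-Computational_Algebra.Polynomial"
begin

(* x^n * cnj(g)(1/x) = g(x) with n = degree g: reflect_poly reverses the coefficients
   up to the actual degree of its argument, see poly_reflect_poly_nz. *)
definition symmetric_poly :: "complex poly \<Rightarrow> bool" where
  "symmetric_poly g \<longleftrightarrow> reflect_poly (map_poly cnj g) = g"

definition delta_poly :: "nat \<Rightarrow> complex poly \<Rightarrow> complex poly" where
  "delta_poly n g = smult (of_nat n / 2) g - [:0, 1:] * pderiv g"

definition open_arc :: "real \<Rightarrow> real \<Rightarrow> complex set" where
  "open_arc s t = cis ` {s<..<t}"

(* Going counterclockwise from cis s, the next root of p on the unit circle is cis t.
   The case t = s + 2 * pi occurs exactly when cis s is the only root on the circle;
   the arc is then the circle with that root removed. *)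
definition consecutive_roots :: "complex poly \<Rightarrow> real \<Rightarrow> real \<Rightarrow> bool" where
  "consecutive_roots p s t \<longleftrightarrow>
     s < t \<and> t \<le> s + 2 * pi \<and> poly p (cis s) = 0 \<and> poly p (cis t) = 0 \<and>
     (\<forall>z\<in>open_arc s t. poly p z \<noteq> 0)"

definition simple_roots_on_circle :: "complex poly \<Rightarrow> bool" where
  "simple_roots_on_circle p \<longleftrightarrow> (\<forall>z. poly p z = 0 \<longrightarrow> order z p = 1 \<and> cmod z = 1)"

definition one_root_between :: "complex poly \<Rightarrow> complex poly \<Rightarrow> bool" where
  "one_root_between p q \<longleftrightarrow>
     (\<forall>s t. consecutive_roots p s t \<longrightarrow> (\<exists>!z. z \<in> open_arc s t \<and> poly q z = 0))"

(* Meant for n >= 1: for n = 0 the conditions are vacuous for nonzero constants. *)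
definition interlacing_roots :: "nat \<Rightarrow> complex poly \<Rightarrow> complex poly \<Rightarrow> bool" where
  "interlacing_roots n p q \<longleftrightarrow>
     degree p = n \<and> degree q = n \<and>
     simple_roots_on_circle p \<and> simple_roots_on_circle q \<and>
     one_root_between p q \<and> one_root_between q p"

end

theory Submission
  imports Defs "HOL-Computational_Algebra.Fundamental_Theorem_Algebra"
begin

text \<open>For a symmetric \<open>f\<close> of degree \<open>n\<close> the function \<open>F(\<theta>) = exp(-in\<theta>/2) f(exp(i\<theta>))\<close> is real, and
  its derivative is \<open>-i exp(-in\<theta>/2) f\<^sub>\<delta>(exp(i\<theta>))\<close>. If \<open>g\<close> and \<open>h\<close> interlace, then \<open>H\<close> changes sign
  between consecutive roots of \<open>G\<close>, so every nontrivial real combination \<open>f\<close> of \<open>g\<close> and \<open>h\<close> has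
  \<open>n\<close> roots on the circle. By Rolle so has \<open>f\<^sub>\<delta>\<close>, whose roots are therefore simple. As no
  nontrivial real combination of \<open>G'\<close> and \<open>H'\<close> has a double zero, their Wronskian never
  vanishes, and Rolle's theorem for \<open>G'/H'\<close> and \<open>H'/G'\<close> gives the interlacing of their zeros.\<close>

section \<open>The real form of a polynomial on the circle\<close>

text \<open>The half power makes this a function of the angle, not of the point: a full turn
  multiplies it by \<open>(-1) ^ n\<close>.\<close>

definition circle_form :: "nat \<Rightarrow> complex poly \<Rightarrow> real \<Rightarrow> complex" where
  "circle_form n p \<theta> = cis (- (real n * \<theta> / 2)) * poly p (cis \<theta>)"

text \<open>Stands in for symmetry because it is stable under real combinations with
  \<open>n\<close> fixed. A nonzero combination of lower degree would violate
  \<open>symmetric_poly\<close>, which reflects at the actual degree.\<close>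

definition real_on_circle :: "nat \<Rightarrow> complex poly \<Rightarrow> bool" where
  "real_on_circle n p \<longleftrightarrow> (\<forall>\<theta>. Im (circle_form n p \<theta>) = 0)"

lemma circle_form_eq_0_iff: "circle_form n p \<theta> = 0 \<longleftrightarrow> poly p (cis \<theta>) = 0"
  by (simp add: circle_form_def)

lemma circle_form_has_vector_derivative:
  "(circle_form n p has_vector_derivative - \<i> * circle_form n (delta_poly n p) \<theta>) (at \<theta>)"
proof -
  \<comment> \<open>Written as an entire function restricted to the real axis, so that complex
    differentiation applies.\<close>
  have eq: "circle_form n p = (\<lambda>x. (\<lambda>z. exp (- \<i> * of_nat n * z / 2) * poly p (exp (\<i> * z))) (of_real x))"
    by (auto simp: circle_form_def fun_eq_iff cis_conv_exp mult_ac)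
  show ?thesis
    unfolding eq
    by (rule has_vector_derivative_real_field)
       (auto intro!: derivative_eq_intros
          simp: circle_form_def delta_poly_def cis_conv_exp algebra_simps)
qed

lemma Re_circle_form_deriv:
  "((\<lambda>x. Re (circle_form n p x)) has_real_derivative Im (circle_form n (delta_poly n p) \<theta>)) (at \<theta>)"
  using has_field_derivative_Re[OF circle_form_has_vector_derivative[of n p \<theta>]] by simp

lemma Im_circle_form_deriv:
  "((\<lambda>x. Im (circle_form n p x)) has_real_derivative - Re (circle_form n (delta_poly n p) \<theta>)) (at \<theta>)"
  using has_field_derivative_Im[OF circle_form_has_vector_derivative[of n p \<theta>]] by simp

text \<open>The imaginary part of the form of \<open>p\<close> is constantly 0, and so is its
  derivative. This is the skew-symmetry of \<open>delta_poly n p\<close> seen on the circle.\<close>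

lemma real_on_circle_delta:
  assumes "real_on_circle n p"
  shows "Re (circle_form n (delta_poly n p) \<theta>) = 0"
proof -
  have "((\<lambda>x. 0) has_real_derivative - Re (circle_form n (delta_poly n p) \<theta>)) (at \<theta>)"
    using Im_circle_form_deriv[of n p \<theta>] assms by (simp add: real_on_circle_def)
  from DERIV_unique[OF this DERIV_const] show ?thesis by simp
qed

lemma real_on_circle_delta_delta:
  assumes "real_on_circle n p"
  shows "real_on_circle n (delta_poly n (delta_poly n p))"
  unfolding real_on_circle_def
proof
  fix \<theta>
  have "((\<lambda>x. 0) has_real_derivative Im (circle_form n (delta_poly n (delta_poly n p)) \<theta>)) (at \<theta>)"
    using Re_circle_form_deriv[of n "delta_poly n p" \<theta>] real_on_circle_delta[OF assms] by simp
  from DERIV_unique[OF this DERIV_const] show "Im (circle_form n (delta_poly n (delta_poly n p)) \<theta>) = 0"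
    by simp
qed

lemma Re_circle_form_eq_0_iff:
  "real_on_circle n p \<Longrightarrow> Re (circle_form n p \<theta>) = 0 \<longleftrightarrow> poly p (cis \<theta>) = 0"
  using circle_form_eq_0_iff[of n p \<theta>] by (auto simp: real_on_circle_def complex_eq_iff)

lemma Im_circle_form_delta_eq_0_iff:
  "real_on_circle n p \<Longrightarrow>
     Im (circle_form n (delta_poly n p) \<theta>) = 0 \<longleftrightarrow> poly (delta_poly n p) (cis \<theta>) = 0"
  using circle_form_eq_0_iff[of n "delta_poly n p" \<theta>] real_on_circle_delta[of n p \<theta>]
  by (auto simp: complex_eq_iff)

text \<open>On the circle \<open>1/x\<close> is the conjugate of \<open>x\<close>, so symmetry reads
  \<open>g = x^n * cnj g\<close>; splitting \<open>x^n\<close> into two half powers makes the form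
  equal to its own conjugate.\<close>

lemma real_on_circle_symmetric:
  assumes "symmetric_poly g"
  shows "real_on_circle (degree g) g"
  unfolding real_on_circle_def
proof
  fix \<theta>
  let ?n = "degree g"
  have "poly g (cis \<theta>) = cis \<theta> ^ ?n * cnj (poly g (cis \<theta>))"
    using poly_reflect_poly_nz[of "cis \<theta>" "map_poly cnj g"] assms
    by (simp add: symmetric_poly_def cis_cnj degree_map_poly)
  hence "circle_form ?n g \<theta> = cis (- (real ?n * \<theta> / 2)) * cis \<theta> ^ ?n * cnj (poly g (cis \<theta>))"
    unfolding circle_form_def by (metis mult.assoc)
  also have "cis (- (real ?n * \<theta> / 2)) * cis \<theta> ^ ?n = cnj (cis (- (real ?n * \<theta> / 2)))"
    by (simp add: DeMoivre cis_mult cis_cnj mult.commute)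
  finally have "circle_form ?n g \<theta> = cnj (circle_form ?n g \<theta>)"
    by (simp add: circle_form_def)
  thus "Im (circle_form ?n g \<theta>) = 0" by (simp add: complex_eq_iff)
qed

section \<open>Real combinations, and delta on coefficients\<close>

lemma circle_form_combination:
  "circle_form n (smult a p + smult b q) \<theta> = a * circle_form n p \<theta> + b * circle_form n q \<theta>"
  by (simp add: circle_form_def algebra_simps)

lemma real_on_circle_combination:
  "real_on_circle n p \<Longrightarrow> real_on_circle n q \<Longrightarrow>
     real_on_circle n (smult (of_real a) p + smult (of_real b) q)"
  by (simp add: real_on_circle_def circle_form_combination)

lemma delta_poly_combination:
  "delta_poly n (smult a p + smult b q) = smult a (delta_poly n p) + smult b (delta_poly n q)"
  by (simp add: delta_poly_def pderiv_add pderiv_smult smult_add_right smult_diff_right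
      algebra_simps)

text \<open>Delta is diagonal on monomials: the factor \<open>-n/2\<close> at the top preserves the
  degree, and only the middle exponent \<open>n/2\<close> can be annihilated.\<close>

lemma coeff_delta_poly: "coeff (delta_poly n p) k = (of_nat n / 2 - of_nat k) * coeff p k"
  by (cases k) (auto simp: delta_poly_def coeff_pderiv coeff_pCons algebra_simps)

lemma degree_delta_poly_le: "degree (delta_poly n p) \<le> degree p"
  by (rule degree_le) (auto simp: coeff_delta_poly coeff_eq_0)

lemma degree_delta_poly:
  assumes "degree p = n" "n \<ge> 1"
  shows "degree (delta_poly n p) = n"
proof (rule antisym)
  show "degree (delta_poly n p) \<le> n" using degree_delta_poly_le[of n p] assms by simp
  have "coeff p n \<noteq> 0" using assms by (metis degree_0 leading_coeff_0_iff not_one_le_zero)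
  thus "n \<le> degree (delta_poly n p)"
    using assms by (intro le_degree) (simp add: coeff_delta_poly)
qed

text \<open>Only the coefficient at \<open>n/2\<close> can survive, so \<open>p\<close> is a
  monomial and vanishes at most at 0. For odd \<open>n\<close> the hypotheses are
  contradictory.\<close>

lemma delta_poly_eq_0_imp_no_nonzero_root:
  assumes "delta_poly n p = 0" "p \<noteq> 0" "z \<noteq> 0"
  shows "poly p z \<noteq> 0"
proof -
  have "coeff p k = 0 \<or> 2 * k = n" for k
  proof -
    have "(of_nat n / 2 - of_nat k) * coeff p k = 0"
      using coeff_delta_poly[of n p k] assms(1) by simp
    moreover have "(of_nat n / 2 - of_nat k :: complex) = 0 \<longleftrightarrow> of_nat (2 * k) = (of_nat n :: complex)"
      by (auto simp: field_simps)
    ultimately show ?thesis by (auto simp del: of_nat_mult)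
  qed
  hence "coeff p k = coeff (monom (coeff p (n div 2)) (n div 2)) k" for k
    by (metis coeff_monom nonzero_mult_div_cancel_left zero_neq_numeral)
  hence eq: "p = monom (coeff p (n div 2)) (n div 2)" by (intro poly_eqI)
  have "poly p z = coeff p (n div 2) * z ^ (n div 2)" by (subst eq) (simp add: poly_monom)
  thus ?thesis using eq assms(2,3) by (metis mult_eq_0_iff power_not_zero monom_eq_0)
qed

section \<open>Arcs and counting roots on the circle\<close>

lemma open_arcI: "s < u \<Longrightarrow> u < t \<Longrightarrow> cis u \<in> open_arc s t"
  by (auto simp: open_arc_def)

lemma cis_eq_imp_ge_2pi:
  assumes "cis u = cis v" "u < v"
  shows "u + 2 * pi \<le> v"
proof -
  have "sin v = sin u \<and> cos v = cos u" using assms(1) by (simp add: complex_eq_iff)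
  then obtain k :: int where k: "v = u + 2 * pi * k" using sin_cos_eq_iff by blast
  with assms(2) have "0 < 2 * pi * of_int k" by simp
  hence "(0::real) < of_int k" by (simp add: zero_less_mult_iff)
  hence "k \<ge> 1" by simp
  hence "2 * pi * 1 \<le> 2 * pi * of_int k" by (intro mult_left_mono) auto
  thus ?thesis using k by simp
qed

lemma cis_add_2pi: "cis (s + 2 * pi) = cis s"
  by (simp flip: cis_mult)

lemma next_root:
  assumes "p \<noteq> 0" "poly p (cis s) = 0"
  obtains t where "consecutive_roots p s t"
proof -
  \<comment> \<open>A half-open range of one full turn meets each point once, so \<open>T\<close> is
    finite. Its right end returns to \<open>cis s\<close>, so \<open>T\<close> is nonempty even for
    a single root.\<close>
  define T where "T = {t\<in>{s<..s + 2 * pi}. poly p (cis t) = 0}"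
  have "inj_on cis T"
  proof (rule inj_onI)
    fix x y assume "x \<in> T" "y \<in> T" "cis x = cis y"
    thus "x = y" using cis_eq_imp_ge_2pi[of x y] cis_eq_imp_ge_2pi[of y x]
      by (auto simp: T_def) (metis add.commute add_less_cancel_right le_less_trans linorder_neqE not_le)
  qed
  moreover have "finite (cis ` T)"
    by (rule finite_subset[OF _ poly_roots_finite[OF assms(1)]]) (auto simp: T_def)
  ultimately have fin: "finite T" by (simp add: finite_image_iff)
  have "s + 2 * pi \<in> T" using assms by (simp add: T_def cis_add_2pi)
  hence "Min T \<in> T" using fin by (intro Min_in) auto
  moreover have "poly p (cis u) \<noteq> 0" if "s < u" "u < Min T" for u
  proof
    assume "poly p (cis u) = 0"
    hence "u \<in> T" using that \<open>Min T \<in> T\<close> by (auto simp: T_def)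
    thus False using Min_le[OF fin] that by fastforce
  qed
  ultimately have "consecutive_roots p s (Min T)"
    using assms(2) by (auto simp: consecutive_roots_def open_arc_def T_def)
  thus thesis by (rule that)
qed

text \<open>The arcs that follow the different roots of \<open>p\<close> are disjoint, so choosing a
  root of \<open>q\<close> on each of them is injective.\<close>

lemma card_circle_roots_le:
  assumes "p \<noteq> 0" "q \<noteq> 0"
    and arcs: "\<And>s t. consecutive_roots p s t \<Longrightarrow> \<exists>u. s < u \<and> u < t \<and> poly q (cis u) = 0"
  shows "card {z. cmod z = 1 \<and> poly p z = 0} \<le> card {z. cmod z = 1 \<and> poly q z = 0}"
proof -
  let ?A = "{z. cmod z = 1 \<and> poly p z = 0}" and ?B = "{z. cmod z = 1 \<and> poly q z = 0}"
  have cisA: "cis (Arg z) = z" if "z \<in> ?A" for z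
    using that cis_Arg[of z] by (cases "z = 0") (auto simp: sgn_div_norm)
  have "\<forall>z\<in>?A. \<exists>u t. consecutive_roots p (Arg z) t \<and> Arg z < u \<and> u < t \<and> poly q (cis u) = 0"
  proof
    fix z assume z: "z \<in> ?A"
    then obtain t where "consecutive_roots p (Arg z) t"
      using next_root[OF assms(1), of "Arg z"] cisA by auto
    thus "\<exists>u t. consecutive_roots p (Arg z) t \<and> Arg z < u \<and> u < t \<and> poly q (cis u) = 0"
      using arcs by blast
  qed
  then obtain u t where ut: "\<And>z. z \<in> ?A \<Longrightarrow> consecutive_roots p (Arg z) (t z) \<and>
      Arg z < u z \<and> u z < t z \<and> poly q (cis (u z)) = 0" by metis
  have neq: "cis (u z) \<noteq> cis (u w)" if z: "z \<in> ?A" and w: "w \<in> ?A" and less: "Arg z < Arg w" for z w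
  proof -
    have no: "\<not> (Arg y < r \<and> r < t y)" if "y \<in> ?A" "poly p (cis r) = 0" for y r
      using ut[OF that(1)] that(2) open_arcI[of "Arg y" r "t y"] by (auto simp: consecutive_roots_def)
    have "t z \<le> Arg w" using no[OF z, of "Arg w"] w cisA[OF w] less by auto
    \<comment> \<open>One turn later the root \<open>z\<close> reappears at
      \<open>Arg z + 2 * pi\<close>, so the arc starting at \<open>w\<close> ends no later. Both
      chosen angles thus lie less than a turn apart.\<close>
    moreover have "Arg w < Arg z + 2 * pi" using Arg_bounded[of z] Arg_bounded[of w] by linarith
    hence "t w \<le> Arg z + 2 * pi" using no[OF w, of "Arg z + 2 * pi"] z cisA[OF z]
      by (auto simp: cis_add_2pi)
    ultimately have "u z < u w" "u w < u z + 2 * pi" using ut[OF z] ut[OF w] by linarith+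
    thus ?thesis using cis_eq_imp_ge_2pi by fastforce
  qed
  have "inj_on (\<lambda>z. cis (u z)) ?A"
  proof (rule inj_onI)
    fix z w assume *: "z \<in> ?A" "w \<in> ?A" "cis (u z) = cis (u w)"
    hence "Arg z = Arg w" using neq[of z w] neq[of w z] by (metis linorder_neqE)
    thus "z = w" using cisA * by metis
  qed
  moreover have "(\<lambda>z. cis (u z)) ` ?A \<subseteq> ?B" using ut by auto
  moreover have "finite ?B" by (rule finite_subset[OF _ poly_roots_finite[OF assms(2)]]) auto
  ultimately show ?thesis by (rule card_inj_on_le)
qed

lemma sum_order_roots_complex:
  "p \<noteq> 0 \<Longrightarrow> (\<Sum>z | poly p z = 0. order z p) = degree (p :: complex poly)"
  using size_proots_complex[of p] by (simp add: size_multiset_overloaded_eq)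

lemma card_circle_roots_simple:
  assumes "simple_roots_on_circle p" "p \<noteq> 0"
  shows "card {z. cmod z = 1 \<and> poly p z = 0} = degree p"
proof -
  have "{z. cmod z = 1 \<and> poly p z = 0} = {z. poly p z = 0}"
    using assms by (auto simp: simple_roots_on_circle_def)
  moreover have "(\<Sum>z | poly p z = 0. order z p) = (\<Sum>z | poly p z = 0. 1)"
    using assms by (intro sum.cong) (auto simp: simple_roots_on_circle_def)
  ultimately show ?thesis using sum_order_roots_complex[OF assms(2)] by simp
qed

text \<open>Multiplicities sum to the degree, so this many distinct roots on the circle leave room
  neither for a root elsewhere nor for a multiple one.\<close>

lemma simple_roots_on_circleI:
  assumes "p \<noteq> 0" and "degree p \<le> card {z. cmod z = 1 \<and> poly p z = 0}"
  shows "simple_roots_on_circle p"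
proof -
  let ?A = "{z. poly p z = 0}" and ?C = "{z. cmod z = 1 \<and> poly p z = 0}"
  have fin: "finite ?A" by (rule poly_roots_finite[OF assms(1)])
  have pos: "order z p \<ge> 1" if "z \<in> ?A" for z
    using that assms(1) order_gt_0_iff[OF assms(1), of z] by auto
  have "card ?A = (\<Sum>z\<in>?A. 1)" by simp
  also have "\<dots> \<le> (\<Sum>z\<in>?A. order z p)" by (intro sum_mono pos)
  finally have le: "card ?A \<le> degree p" by (simp add: sum_order_roots_complex[OF assms(1)])
  have "?C = ?A" by (rule card_seteq[OF fin]) (use le assms(2) in auto)
  moreover have "order z p = 1" if z: "z \<in> ?A" for z
  proof (rule ccontr)
    assume "order z p \<noteq> 1"
    hence "1 < order z p" using pos[OF z] by simp
    hence "(\<Sum>z\<in>?A. 1) < (\<Sum>z\<in>?A. order z p)"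
      using fin z by (intro sum_strict_mono_ex1) (auto simp: pos[simplified])
    thus False using assms(2) \<open>?C = ?A\<close> by (simp add: sum_order_roots_complex[OF assms(1)])
  qed
  ultimately show ?thesis by (auto simp: simple_roots_on_circle_def)
qed

text \<open>At a root of \<open>p\<close> delta reduces to \<open>- z * p'(z)\<close>, and
  \<open>p'\<close> does not vanish at a simple root.\<close>

lemma simple_root_delta_poly_nz:
  assumes "p \<noteq> 0" "poly p z = 0" "order z p = 1" "z \<noteq> 0"
  shows "poly (delta_poly n p) z \<noteq> 0"
proof -
  have p': "order z (pderiv p) = 0" using order_pderiv[OF assms(1,2)] assms(3) by simp
  have "pderiv p \<noteq> 0"
    using pderiv_iszero[of p] assms(1,2) by auto
  with p' have "poly (pderiv p) z \<noteq> 0" by (simp add: order_root)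
  thus ?thesis using assms by (simp add: delta_poly_def)
qed

section \<open>Rolle's theorem\<close>

text \<open>Rolle for \<open>u / v\<close>, with the numerator of the derivative as conclusion. The
  choice \<open>v = 1\<close> gives plain Rolle; in general it locates a zero of the
  Wronskian.\<close>

lemma rolle_quotient:
  fixes u v :: "real \<Rightarrow> real"
  assumes "s < t" and u: "\<And>x. (u has_real_derivative u' x) (at x)"
    and v: "\<And>x. (v has_real_derivative v' x) (at x)"
    and "u s = 0" "u t = 0" and nz: "\<And>x. s \<le> x \<Longrightarrow> x \<le> t \<Longrightarrow> v x \<noteq> 0"
  obtains x where "s < x" "x < t" "u' x * v x - u x * v' x = 0"
proof -
  have d: "((\<lambda>x. u x / v x) has_real_derivative (u' x * v x - u x * v' x) / (v x * v x)) (at x)"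
    if "s \<le> x" "x \<le> t" for x
    by (rule DERIV_divide[OF u v nz[OF that]])
  have "\<exists>x. s < x \<and> x < t \<and> (*) ((u' x * v x - u x * v' x) / (v x * v x)) = (\<lambda>v. 0)"
  proof (rule Rolle_deriv[OF assms(1)])
    show "continuous_on {s..t} (\<lambda>x. u x / v x)"
      by (rule DERIV_continuous_on[OF DERIV_subset[OF d]]) auto
  qed (use assms d in \<open>auto simp: has_field_derivative_def\<close>)
  then obtain x where x: "s < x" "x < t"
    and "(*) ((u' x * v x - u x * v' x) / (v x * v x)) = (\<lambda>v. 0)" by blast
  \<comment> \<open>The derivative is given as a linear map, and its value at 1 is the
    quotient.\<close>
  from fun_cong[OF this(3), of 1] nz[of x] x have "u' x * v x - u x * v' x = 0" by auto
  with x show thesis by (rule that)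
qed

lemma rolle_circle:
  assumes "real_on_circle n f" "s < t" "poly f (cis s) = 0" "poly f (cis t) = 0"
  shows "\<exists>u. s < u \<and> u < t \<and> poly (delta_poly n f) (cis u) = 0"
proof -
  obtain x where "s < x" "x < t" "Im (circle_form n (delta_poly n f) x) = 0"
    using rolle_quotient[OF assms(2) Re_circle_form_deriv[of n f], of "\<lambda>x. 1" "\<lambda>x. 0"]
      assms Re_circle_form_eq_0_iff by (auto simp: circle_form_def)
  thus ?thesis using Im_circle_form_delta_eq_0_iff[OF assms(1)] by blast
qed

section \<open>Sign changes forced by interlacing\<close>

text \<open>From a common root at \<open>s\<close>, let \<open>u\<close> be the angle of the root of
  \<open>q\<close> before the next root of \<open>p\<close>. Then \<open>s\<close> and
  \<open>u\<close> are consecutive for \<open>q\<close>, yet \<open>p\<close> has no root between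
  them.\<close>

lemma interlacing_no_common_root:
  assumes "p \<noteq> 0" "one_root_between p q" "one_root_between q p" "poly p (cis s) = 0"
  shows "poly q (cis s) \<noteq> 0"
proof
  assume q: "poly q (cis s) = 0"
  obtain t where t: "consecutive_roots p s t" using next_root assms by blast
  then obtain z where z: "z \<in> open_arc s t" "poly q z = 0"
    and uniq: "\<And>w. w \<in> open_arc s t \<Longrightarrow> poly q w = 0 \<Longrightarrow> w = z"
    using assms(2) unfolding one_root_between_def by blast
  from z(1) obtain u where u: "z = cis u" "s < u" "u < t" by (auto simp: open_arc_def)
  have "poly q w \<noteq> 0" if "w \<in> open_arc s u" for w
  proof
    assume w: "poly q w = 0"
    obtain x where x: "w = cis x" "s < x" "x < u" using \<open>w \<in> open_arc s u\<close> by (auto simp: open_arc_def)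
    have "cis x = cis u" using uniq[OF open_arcI[of s x t]] w x u by simp
    from cis_eq_imp_ge_2pi[OF this x(3)] show False
      using x u t by (auto simp: consecutive_roots_def)
  qed
  hence "consecutive_roots q s u"
    using q z u t by (auto simp: consecutive_roots_def)
  then obtain w where "w \<in> open_arc s u" "poly p w = 0"
    using assms(3) unfolding one_root_between_def by blast
  thus False using t u by (fastforce simp: consecutive_roots_def open_arc_def)
qed

text \<open>On the arc \<open>q\<close> has a single zero. With equal signs at the ends the real
  form would only touch 0 there, contradicting simplicity.\<close>

lemma interlacing_sign_change:
  assumes "real_on_circle n q" "q \<noteq> 0" "simple_roots_on_circle q"
    and "p \<noteq> 0" "one_root_between p q" "one_root_between q p" and st: "consecutive_roots p s t"
  shows "Re (circle_form n q s) * Re (circle_form n q t) < 0"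
proof (rule ccontr)
  assume same_sign: "\<not> ?thesis"
  \<comment> \<open>The factor normalizes the sign, making \<open>K\<close> positive at
    \<open>s\<close> and, under the assumption, at \<open>t\<close>.\<close>
  define K where "K x = Re (circle_form n q s) * Re (circle_form n q x)" for x
  have s0: "poly q (cis s) \<noteq> 0" "poly q (cis t) \<noteq> 0"
    using interlacing_no_common_root[of p q] assms by (auto simp: consecutive_roots_def)
  have K0: "K x = 0 \<longleftrightarrow> poly q (cis x) = 0" for x
    using s0 Re_circle_form_eq_0_iff[OF assms(1)] by (simp add: K_def)
  have Ks: "K s > 0" using K0[of s] s0 by (auto simp: K_def zero_less_mult_iff)
  have Kt: "K t > 0" using K0[of t] s0 same_sign by (simp add: K_def not_less order_less_le)
  have dK: "(K has_real_derivative Re (circle_form n q s) * Im (circle_form n (delta_poly n q) x)) (at x)" for x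
    unfolding K_def using DERIV_cmult[OF Re_circle_form_deriv] by blast
  obtain z where z: "z \<in> open_arc s t" "poly q z = 0"
    and uniq: "\<And>w. w \<in> open_arc s t \<Longrightarrow> poly q w = 0 \<Longrightarrow> w = z"
    using assms(5) st unfolding one_root_between_def by blast
  from z(1) obtain u where u: "z = cis u" "s < u" "u < t" by (auto simp: open_arc_def)
  have Kzero: "x = u" if "s < x" "x < t" "K x = 0" for x
  proof -
    have "cis x = cis u" using uniq[OF open_arcI[of s x t]] that K0 u by simp
    thus ?thesis using cis_eq_imp_ge_2pi[of x u] cis_eq_imp_ge_2pi[of u x] that u st
      by (fastforce simp: consecutive_roots_def)
  qed
  have cK: "isCont K x" for x using dK DERIV_isCont by blast
  \<comment> \<open>A negative value at \<open>v\<close> would force zeros on both sides of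
    \<open>v\<close>, but \<open>u\<close> is the only zero.\<close>
  have nonneg: "K v \<ge> 0" if v: "s < v" "v < t" for v
  proof (rule ccontr)
    assume neg: "\<not> K v \<ge> 0"
    have "K u = 0" using K0 z u by simp
    hence "v \<noteq> u" using neg by auto
    obtain a where a: "s \<le> a" "a \<le> v" "K a = 0"
      using IVT2[of K v 0 s] cK neg Ks v by auto
    obtain b where b: "v \<le> b" "b \<le> t" "K b = 0"
      using IVT[of K v 0 t] cK neg Kt v by auto
    have "a \<noteq> s" "b \<noteq> t" using a b Ks Kt by auto
    hence "a = u" "b = u" using Kzero[of a] Kzero[of b] a b v by auto
    thus False using a b \<open>v \<noteq> u\<close> by simp
  qed
  have Ku: "K u = 0" using K0 z u by simp
  have "Re (circle_form n q s) * Im (circle_form n (delta_poly n q) u) = 0"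
  proof (rule DERIV_local_min[OF dK])
    show "0 < min (u - s) (t - u)" using u by simp
    show "\<forall>y. \<bar>u - y\<bar> < min (u - s) (t - u) \<longrightarrow> K u \<le> K y"
      using nonneg Ku by (auto simp: abs_if split: if_splits)
  qed
  hence "Im (circle_form n (delta_poly n q) u) = 0" using Ks by (auto simp: K_def)
  hence "poly (delta_poly n q) z = 0" using Im_circle_form_delta_eq_0_iff[OF assms(1)] u by simp
  moreover have "order z q = 1" using assms(3) z by (auto simp: simple_roots_on_circle_def)
  ultimately show False using simple_root_delta_poly_nz[OF assms(2) z(2)] u by simp
qed

section \<open>The real pencil spanned by the two polynomials\<close>

lemma pencil_delta_simple:
  assumes "n \<ge> 1" "real_on_circle n g" "real_on_circle n h" and I: "interlacing_roots n g h"
    and ab: "a \<noteq> 0 \<or> b \<noteq> (0::real)"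
  defines "f \<equiv> smult (of_real a) g + smult (of_real b) h"
  shows "delta_poly n f \<noteq> 0" "simple_roots_on_circle (delta_poly n f)"
proof -
  note [simp] = interlacing_roots_def
  have gh: "g \<noteq> 0" "h \<noteq> 0" using assms(1) I by auto
  have cg: "card {z. cmod z = 1 \<and> poly g z = 0} = n"
    using card_circle_roots_simple[of g] gh I by auto
  hence "{z. cmod z = 1 \<and> poly g z = 0} \<noteq> {}" using assms(1) by (metis card.empty not_one_le_zero)
  then obtain z0 where z0: "cmod z0 = 1" "poly g z0 = 0" by blast
  hence z0': "cis (Arg z0) = z0" using cis_Arg[of z0] by (cases "z0 = 0") (auto simp: sgn_div_norm)
  have nocommon: "poly h (cis s) \<noteq> 0" if "poly g (cis s) = 0" for s
    using interlacing_no_common_root[of g h s] gh I that by auto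
  have f0: "f \<noteq> 0"
  proof
    assume "f = 0"
    hence "poly f z0 = 0" by simp
    hence "b = 0" using nocommon[of "Arg z0"] z0 z0' by (simp add: f_def)
    thus False using \<open>f = 0\<close> ab gh by (simp add: f_def)
  qed
  have rf: "real_on_circle n f" unfolding f_def by (rule real_on_circle_combination[OF assms(2,3)])
  have "n \<le> card {z. cmod z = 1 \<and> poly f z = 0}"
  proof (cases "b = 0")
    case True
    thus ?thesis using cg ab by (simp add: f_def)
  next
    case False
    have "card {z. cmod z = 1 \<and> poly g z = 0} \<le> card {z. cmod z = 1 \<and> poly f z = 0}"
    proof (rule card_circle_roots_le[OF gh(1) f0])
      fix s t assume st: "consecutive_roots g s t"
      let ?F = "\<lambda>x. Re (circle_form n f x)" and ?H = "\<lambda>x. Re (circle_form n h x)"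
      \<comment> \<open>At the roots of \<open>g\<close> only the \<open>h\<close> term remains, so
        \<open>f\<close> inherits the sign change of \<open>h\<close> whenever \<open>b\<close> is
        nonzero.\<close>
      have F: "?F x = b * ?H x" if "poly g (cis x) = 0" for x
        using that circle_form_eq_0_iff[of n g x] by (simp add: f_def circle_form_combination)
      have cont: "isCont ?F x" for x using Re_circle_form_deriv DERIV_isCont by blast
      have "?H s * ?H t < 0"
        by (rule interlacing_sign_change[of n h g]) (use assms gh st in auto)
      moreover have "b * b > 0" using False by (auto simp: zero_less_mult_iff)
      ultimately have "(b * b) * (?H s * ?H t) < 0" by (rule mult_pos_neg[rotated])
      hence neg: "?F s * ?F t < 0" using F st by (simp add: consecutive_roots_def mult_ac)
      have "s \<le> t" using st by (simp add: consecutive_roots_def)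
      have "\<exists>x. s \<le> x \<and> x \<le> t \<and> ?F x = 0"
      proof (cases "?F s < 0")
        case True
        hence "?F t \<ge> 0" using neg by (simp add: mult_less_0_iff)
        thus ?thesis using True cont \<open>s \<le> t\<close> by (intro IVT) simp_all
      next
        case False
        hence "?F s \<ge> 0" "?F t \<le> 0" using neg by (simp_all add: mult_less_0_iff)
        thus ?thesis using cont \<open>s \<le> t\<close> by (intro IVT2) simp_all
      qed
      then obtain x where x: "s \<le> x" "x \<le> t" "?F x = 0" by blast
      hence "x \<noteq> s" "x \<noteq> t" using neg by auto
      thus "\<exists>u>s. u < t \<and> poly f (cis u) = 0"
        using x Re_circle_form_eq_0_iff[OF rf] by (intro exI[of _ x]) auto
    qed
    thus ?thesis using cg by simp
  qed
  hence "{z. cmod z = 1 \<and> poly f z = 0} \<noteq> {}" using assms(1) by (metis card.empty not_one_le_zero le_trans)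
  then obtain z where z: "cmod z = 1" "poly f z = 0" by blast
  have "z \<noteq> 0" using z by auto
  thus d0: "delta_poly n f \<noteq> 0" using delta_poly_eq_0_imp_no_nonzero_root f0 z by blast
  \<comment> \<open>Rolle puts a root of \<open>delta_poly n f\<close> on every arc between roots of
    \<open>f\<close>: at least \<open>n\<close> roots against degree at most
    \<open>n\<close>.\<close>
  have "card {z. cmod z = 1 \<and> poly f z = 0} \<le> card {z. cmod z = 1 \<and> poly (delta_poly n f) z = 0}"
    by (rule card_circle_roots_le[OF f0 d0], rule rolle_circle[OF rf])
       (auto simp: consecutive_roots_def)
  moreover have "degree (delta_poly n f) \<le> n"
    unfolding f_def using I
    by (intro order_trans[OF degree_delta_poly_le] degree_add_le order_trans[OF degree_smult_le]) auto
  ultimately show "simple_roots_on_circle (delta_poly n f)"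
    using \<open>n \<le> card {z. cmod z = 1 \<and> poly f z = 0}\<close> by (intro simple_roots_on_circleI[OF d0]) auto
qed

section \<open>Wronskian and interlacing\<close>

lemma singular_2x2_kernel:
  fixes p q p' q' :: real
  assumes "p' * q - p * q' = 0"
  obtains a b where "a \<noteq> 0 \<or> b \<noteq> 0" "a * p + b * q = 0" "a * p' + b * q' = 0"
proof (cases "p = 0 \<and> q = 0")
  case True
  show thesis
    by (cases "p' = 0 \<and> q' = 0") (use True that[of 1 0] that[of q' "-p'"] in auto)
next
  case False
  thus thesis using that[of q "-p"] assms by (auto simp: algebra_simps)
qed

text \<open>\<open>u p\<close> and \<open>u' p\<close> are the first and second derivatives of the
  real form of \<open>p\<close>. A zero of the Wronskian yields a member \<open>f\<close> of the
  pencil for which both vanish at \<open>x\<close>.\<close>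

lemma wronskian_delta_nz:
  assumes "n \<ge> 1" "real_on_circle n g" "real_on_circle n h" "interlacing_roots n g h"
  defines "u \<equiv> \<lambda>p x. Im (circle_form n (delta_poly n p) x)"
    and "u' \<equiv> \<lambda>p x. - Re (circle_form n (delta_poly n (delta_poly n p)) x)"
  shows "u' g x * u h x - u g x * u' h x \<noteq> 0"
proof
  assume "u' g x * u h x - u g x * u' h x = 0"
  then obtain a b where ab: "a \<noteq> 0 \<or> b \<noteq> 0"
    "a * u g x + b * u h x = 0" "a * u' g x + b * u' h x = 0"
    by (rule singular_2x2_kernel)
  define f where "f = smult (of_real a) g + smult (of_real b) h"
  have rf: "real_on_circle n f" unfolding f_def by (rule real_on_circle_combination[OF assms(2,3)])
  have "u f x = 0" using ab by (simp add: u_def f_def delta_poly_combination circle_form_combination)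
  hence 1: "poly (delta_poly n f) (cis x) = 0"
    using Im_circle_form_delta_eq_0_iff[OF rf] by (simp add: u_def)
  have "u' f x = 0" using ab
    by (simp add: u'_def f_def delta_poly_combination circle_form_combination)
  hence 2: "poly (delta_poly n (delta_poly n f)) (cis x) = 0"
    using Re_circle_form_eq_0_iff[OF real_on_circle_delta_delta[OF rf]] by (simp add: u'_def)
  have "delta_poly n f \<noteq> 0" "simple_roots_on_circle (delta_poly n f)"
    unfolding f_def using pencil_delta_simple[OF assms(1-4) ab(1)] by auto
  \<comment> \<open>A common root of \<open>delta_poly n f\<close> and its own delta is a multiple
    root of \<open>delta_poly n f\<close>.\<close>
  with simple_root_delta_poly_nz[OF _ 1] 1 2 show False
    by (auto simp: simple_roots_on_circle_def)
qed

text \<open>Rolle for \<open>u / v\<close> gives existence of a zero of \<open>v\<close> on the arc,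
  and Rolle for \<open>v / u\<close> gives uniqueness.\<close>

lemma one_root_between_of_wronskian:
  assumes u: "\<And>x. (u has_real_derivative u' x) (at x)" and v: "\<And>x. (v has_real_derivative v' x) (at x)"
    and p: "\<And>x. poly p (cis x) = 0 \<longleftrightarrow> u x = 0" and q: "\<And>x. poly q (cis x) = 0 \<longleftrightarrow> v x = 0"
    and W: "\<And>x. u' x * v x - u x * v' x \<noteq> 0"
  shows "one_root_between p q"
  unfolding one_root_between_def
proof (intro allI impI)
  fix s t assume st: "consecutive_roots p s t"
  hence s: "s < t" "u s = 0" "u t = 0" by (auto simp: consecutive_roots_def p)
  have nz: "u x \<noteq> 0" if "s < x" "x < t" for x
    using st open_arcI[OF that] p by (auto simp: consecutive_roots_def)
  have "\<exists>x. s \<le> x \<and> x \<le> t \<and> v x = 0"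
    using rolle_quotient[OF s(1) u v s(2,3)] W by metis
  then obtain x where x: "s \<le> x" "x \<le> t" "v x = 0" by blast
  \<comment> \<open>A common zero of \<open>u\<close> and \<open>v\<close> at an end of the arc
    would annihilate the Wronskian.\<close>
  have "x \<noteq> s" "x \<noteq> t" using W[of s] W[of t] s x by auto
  with x have x': "s < x" "x < t" by auto
  have no_pair: False if yz: "s < y" "y < z" "z < t" "v y = 0" "v z = 0" for y z
  proof (rule rolle_quotient[OF yz(2) v u yz(4,5)])
    show "u r \<noteq> 0" if "y \<le> r" "r \<le> z" for r using nz that yz by auto
    show False if "v' r * u r - v r * u' r = 0" for r
      using W[of r] that by (simp add: algebra_simps)
  qed
  show "\<exists>!z. z \<in> open_arc s t \<and> poly q z = 0"
  proof (rule ex1I[of _ "cis x"])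
    show "cis x \<in> open_arc s t \<and> poly q (cis x) = 0" using x x' q by (simp add: open_arcI)
    fix z assume "z \<in> open_arc s t \<and> poly q z = 0"
    then obtain y where y: "z = cis y" "s < y" "y < t" "v y = 0" by (auto simp: open_arc_def q)
    thus "z = cis x" using no_pair[of x y] no_pair[of y x] x x' by (cases x y rule: linorder_cases) auto
  qed
qed

theorem theorem5:
  fixes n :: nat and g h :: "complex poly"
  assumes "n \<ge> 1"
    and "degree g = n" and "degree h = n"
    and "symmetric_poly g" and "symmetric_poly h"
    and "interlacing_roots n g h"
  shows "interlacing_roots n (delta_poly n g) (delta_poly n h)"
proof -
  have rg: "real_on_circle n g" and rh: "real_on_circle n h"
    using real_on_circle_symmetric[OF assms(4)] real_on_circle_symmetric[OF assms(5)] assms(2,3)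
    by simp_all
  note simple = pencil_delta_simple(2)[OF assms(1) rg rh assms(6)]
  note W = wronskian_delta_nz[OF assms(1) rg rh assms(6)]
  note zg = Im_circle_form_delta_eq_0_iff[OF rg, symmetric]
    and zh = Im_circle_form_delta_eq_0_iff[OF rh, symmetric]
  have "one_root_between (delta_poly n g) (delta_poly n h)"
    by (rule one_root_between_of_wronskian[OF Im_circle_form_deriv Im_circle_form_deriv zg zh W])
  moreover have "one_root_between (delta_poly n h) (delta_poly n g)"
  proof (rule one_root_between_of_wronskian[OF Im_circle_form_deriv Im_circle_form_deriv zh zg])
    fix x
    show "- Re (circle_form n (delta_poly n (delta_poly n h)) x) * Im (circle_form n (delta_poly n g) x)
      - Im (circle_form n (delta_poly n h) x) * - Re (circle_form n (delta_poly n (delta_poly n g)) x) \<noteq> 0"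
      using W[of x] by (simp add: algebra_simps)
  qed
  moreover have "simple_roots_on_circle (delta_poly n g)" "simple_roots_on_circle (delta_poly n h)"
    \<comment> \<open>The two polynomials themselves are the members \<open>(1, 0)\<close> and
      \<open>(0, 1)\<close> of the pencil.\<close>
    using simple[of 1 0] simple[of 0 1] by auto
  ultimately show ?thesis
    using degree_delta_poly[OF assms(2,1)] degree_delta_poly[OF assms(3,1)]
    by (simp add: interlacing_roots_def)
qed

end
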